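(* Consider the block Gibbs sampler defined in the context, with $K\ge3$ and $m_i\ge2$ for all $i$. Let $$\delta_1=\frac{1}{2a_1+K-2},\quad \delta_2=\frac{1}{2a_2+M-2},\quad \delta_3=(K+1)\delta_2,\quad \delta_4=\delta_2\sum_{i=1}^K m_i^{-1},\quad \delta=\max\{\delta_1,\delta_3\},$$ $$c_1=\frac{2b_1}{2a_1+K-2},\qquad c_2=\frac{2b_2+\mathrm{SSE}}{2a_2+M-2},$$ and let $\Delta$ denote the length of the convex hull of the set $\{\bar y_1,\ldots,\bar y_K,m_0\}$. Fix $\gamma\in(\delta,1)$ and let $\phi_1,\phi_2$ be positive numbers such that $\frac{\phi_1\delta_4}{\phi_2}+\delta<\gamma$. Define $V_1(\theta,\mu)=\phi_1 v_1(\theta,\mu)+\phi_2 v_2(\theta)$. Then, for every current state $(\lambda',\theta',\mu')\in\mathbb{R}_+^2\times\mathbb{R}^K\times\mathbb{R}$, the next state $(\lambda,\theta,\mu)$ of the block Gibbs sampler satisfies $$E[V_1(\theta,\mu)\mid\lambda',\theta',\mu']\le\gamma V_1(\theta',\mu')+b,$$ where $$b=\phi_1\left[c_1+c_2\sum_{i=1}^K m_i^{-1}+K\Delta^2\right]+\phi_2\left[c_2(K+1)+M\Delta^2\right].$$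
   Context: Model. $K$ and $m_1,\ldots,m_K$ are positive integers, $M=\sum_{i=1}^K m_i$, and $y=(y_{ij})$, $1\le i\le K$, $1\le j\le m_i$, is fixed real data. $a_1,b_1,a_2,b_2,s_0$ are known positive constants and $m_0\in\mathbb{R}$ is known. $\mathrm{Gamma}(\alpha,\beta)$ has density proportional to $w^{\alpha-1}e^{-w\beta}I(w>0)$. Hierarchical model: given $\theta=(\theta_1,\ldots,\theta_K)^T$ and $\lambda_e$, the $Y_{ij}$ are independent with $Y_{ij}\sim\mathrm{N}(\theta_i,\lambda_e^{-1})$; given $\mu,\lambda_\theta$, the variables $\theta_1,\ldots,\theta_K,\lambda_e$ are independent with $\theta_i\sim\mathrm{N}(\mu,\lambda_\theta^{-1})$ and $\lambda_e\sim\mathrm{Gamma}(a_2,b_2)$; $\mu\sim\mathrm{N}(m_0,s_0^{-1})$ and $\lambda_\theta\sim\mathrm{Gamma}(a_1,b_1)$ are independent. Write $\lambda=(\lambda_\theta,\lambda_e)^T$ and $\xi=(\theta_1,\ldots,\theta_K,\mu)^T$. The posterior is the conditional distribution of $(\theta,\mu,\lambda)$ given $Y=y$. Notation: $\bar y_i=m_i^{-1}\sum_{j}y_{ij}$, $\mathrm{SSE}=\sum_{i,j}(y_{ij}-\bar y_i)^2$, $v_1(\theta,\mu)=\sum_{i=1}^K(\theta_i-\mu)^2$, $v_2(\theta)=\sum_{i=1}^K m_i(\theta_i-\bar y_i)^2$. Block Gibbs sampler. The Markov chain on $(\lambda,\xi)\in\mathbb{R}_+^2\times\mathbb{R}^{K+1}$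 whose transition $(\lambda',\xi')\to(\lambda,\xi)$ has density $k(\lambda,\xi\mid\lambda',\xi')=f(\lambda_\theta\mid\xi',y)f(\lambda_e\mid\xi',y)f(\xi\mid\lambda,y)$, where the $f$'s are the posterior conditional densities: $\lambda_\theta\mid\xi,y\sim\mathrm{Gamma}\left(\frac K2+a_1,\frac{v_1(\theta,\mu)}2+b_1\right)$, $\lambda_e\mid\xi,y\sim\mathrm{Gamma}\left(\frac M2+a_2,\frac{v_2(\theta)+\mathrm{SSE}}2+b_2\right)$, and $\xi\mid\lambda,y$ is multivariate normal with, for $t=\sum_{i=1}^K\frac{m_i\lambda_\theta\lambda_e}{\lambda_\theta+m_i\lambda_e}$, $E(\mu\mid\lambda)=\frac1{s_0+t}\left[\sum_{i=1}^K\frac{m_i\lambda_\theta\lambda_e\bar y_i}{\lambda_\theta+m_i\lambda_e}+m_0s_0\right]$, $E(\theta_i\mid\lambda)=\frac{\lambda_\theta E(\mu\mid\lambda)+m_i\lambda_e\bar y_i}{\lambda_\theta+m_i\lambda_e}$, $\mathrm{Var}(\mu\mid\lambda)=\frac1{s_0+t}$, $\mathrm{Var}(\theta_i\mid\lambda)=\frac1{\lambda_\theta+m_i\lambda_e}\left[1+\frac{\lambda_\theta^2}{(\lambda_\theta+m_i\lambda_e)(s_0+t)}\right]$, $\mathrm{Cov}(\theta_i,\mu\mid\lambda)=\frac{\lambda_\theta}{(\lambda_\theta+m_i\lambda_e)(s_0+t)}$, $\mathrm{Cov}(\theta_i,\theta_j\mid\lambda)=\frac{\lambda_\theta^2}{(\lambda_\theta+m_i\lambda_e)(\lambda_\theta+m_j\lambda_e)(s_0+t)}$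 for $i\ne j$. *)

theory Defs
  imports "HOL-Probability.Probability"
begin

text \<open>The index type \<open>'k\<close> plays the role of \<open>{1, ..., K}\<close>, so \<open>K = CARD('k)\<close>. The datum \<open>y i j\<close> is
  meaningful for \<open>1 \<le> j \<le> m i\<close> only; no definition below looks at other values of \<open>j\<close>.\<close>

definition ybar :: "('k::finite \<Rightarrow> nat) \<Rightarrow> ('k \<Rightarrow> nat \<Rightarrow> real) \<Rightarrow> 'k \<Rightarrow> real" where
  "ybar m y i = (\<Sum>j=1..m i. y i j) / real (m i)"

definition SSE :: "('k::finite \<Rightarrow> nat) \<Rightarrow> ('k \<Rightarrow> nat \<Rightarrow> real) \<Rightarrow> real" where
  "SSE m y = (\<Sum>i\<in>UNIV. \<Sum>j=1..m i. (y i j - ybar m y i)\<^sup>2)"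

definition v1 :: "real ^ 'k::finite \<Rightarrow> real \<Rightarrow> real" where
  "v1 \<theta> \<mu> = (\<Sum>i\<in>UNIV. (\<theta> $ i - \<mu>)\<^sup>2)"

definition v2 :: "('k::finite \<Rightarrow> nat) \<Rightarrow> ('k \<Rightarrow> nat \<Rightarrow> real) \<Rightarrow> real ^ 'k \<Rightarrow> real" where
  "v2 m y \<theta> = (\<Sum>i\<in>UNIV. real (m i) * (\<theta> $ i - ybar m y i)\<^sup>2)"

text \<open>The vector \<open>\<xi> = (\<theta>\<^sub>1, ..., \<theta>\<^sub>K, \<mu>)\<close> is indexed by \<open>'k option\<close>: coordinate \<open>Some i\<close> is
  \<open>\<theta>\<^sub>i\<close> and coordinate \<open>None\<close> is \<open>\<mu>\<close>.\<close>

definition theta_of :: "real ^ 'k::finite option \<Rightarrow> real ^ 'k" where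
  "theta_of \<xi> = (\<chi> i. \<xi> $ Some i)"

definition mu_of :: "real ^ 'k::finite option \<Rightarrow> real" where
  "mu_of \<xi> = \<xi> $ None"

text \<open>Shape-rate parametrization.\<close>

definition gamma_density :: "real \<Rightarrow> real \<Rightarrow> real \<Rightarrow> real" where
  "gamma_density \<alpha> \<beta> w =
     (if w > 0 then \<beta> powr \<alpha> / Gamma \<alpha> * w powr (\<alpha> - 1) * exp (- (w * \<beta>)) else 0)"

definition mvnormal_density :: "real ^ 'n::finite \<Rightarrow> real ^ 'n ^ 'n \<Rightarrow> real ^ 'n \<Rightarrow> real" where
  "mvnormal_density \<nu> \<Sigma> x =
     exp (- ((x - \<nu>) \<bullet> (matrix_inv \<Sigma> *v (x - \<nu>))) / 2) / sqrt ((2 * pi) ^ CARD('n) * det \<Sigma>)"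

text \<open>In the following, \<open>lt\<close> and \<open>le\<close> stand for \<open>\<lambda>\<^sub>\<theta>\<close> and \<open>\<lambda>\<^sub>e\<close>.\<close>

definition t_sum :: "('k::finite \<Rightarrow> nat) \<Rightarrow> real \<Rightarrow> real \<Rightarrow> real" where
  "t_sum m lt le = (\<Sum>i\<in>UNIV. real (m i) * lt * le / (lt + real (m i) * le))"

definition mu_mean ::
  "('k::finite \<Rightarrow> nat) \<Rightarrow> ('k \<Rightarrow> nat \<Rightarrow> real) \<Rightarrow> real \<Rightarrow> real \<Rightarrow> real \<Rightarrow> real \<Rightarrow> real" where
  "mu_mean m y m0 s0 lt le =
     1 / (s0 + t_sum m lt le) *
     ((\<Sum>i\<in>UNIV. real (m i) * lt * le * ybar m y i / (lt + real (m i) * le)) + m0 * s0)"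

definition xi_mean ::
  "('k::finite \<Rightarrow> nat) \<Rightarrow> ('k \<Rightarrow> nat \<Rightarrow> real) \<Rightarrow> real \<Rightarrow> real \<Rightarrow> real \<Rightarrow> real \<Rightarrow> real ^ 'k option" where
  "xi_mean m y m0 s0 lt le = (\<chi> p. case p of
       None \<Rightarrow> mu_mean m y m0 s0 lt le
     | Some i \<Rightarrow> (lt * mu_mean m y m0 s0 lt le + real (m i) * le * ybar m y i) / (lt + real (m i) * le))"

definition xi_cov ::
  "('k::finite \<Rightarrow> nat) \<Rightarrow> real \<Rightarrow> real \<Rightarrow> real \<Rightarrow> real ^ 'k option ^ 'k option" where
  "xi_cov m s0 lt le = (\<chi> p q. case (p, q) of
       (None, None) \<Rightarrow> 1 / (s0 + t_sum m lt le)
     | (Some i, None) \<Rightarrow> lt / ((lt + real (m i) * le) * (s0 + t_sum m lt le))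
     | (None, Some i) \<Rightarrow> lt / ((lt + real (m i) * le) * (s0 + t_sum m lt le))
     | (Some i, Some j) \<Rightarrow>
         (if i = j
          then 1 / (lt + real (m i) * le) *
               (1 + lt\<^sup>2 / ((lt + real (m i) * le) * (s0 + t_sum m lt le)))
          else lt\<^sup>2 / ((lt + real (m i) * le) * (lt + real (m j) * le) * (s0 + t_sum m lt le))))"

text \<open>A state is a pair \<open>(\<lambda>, \<xi>)\<close> with \<open>\<lambda> = (\<lambda>\<^sub>\<theta>, \<lambda>\<^sub>e)\<close>. The factors \<^const>\<open>gamma_density\<close> vanish
  unless both components of the new \<open>\<lambda>\<close> are positive.\<close>

type_synonym 'k state = "(real \<times> real) \<times> (real ^ 'k option)"

definition gibbs_density ::
  "real \<Rightarrow> real \<Rightarrow> real \<Rightarrow> real \<Rightarrow> real \<Rightarrow> real \<Rightarrow> ('k::finite \<Rightarrow> nat) \<Rightarrow> ('k \<Rightarrow> nat \<Rightarrow> real) \<Rightarrow>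
   'k state \<Rightarrow> 'k state \<Rightarrow> real" where
  "gibbs_density a1 b1 a2 b2 m0 s0 m y = (\<lambda>(_, \<xi>') ((lt, le), \<xi>).
     gamma_density (real CARD('k) / 2 + a1) (v1 (theta_of \<xi>') (mu_of \<xi>') / 2 + b1) lt *
     gamma_density (real (\<Sum>i\<in>UNIV. m i) / 2 + a2) ((v2 m y (theta_of \<xi>') + SSE m y) / 2 + b2) le *
     mvnormal_density (xi_mean m y m0 s0 lt le) (xi_cov m s0 lt le) \<xi>)"

text \<open>The law of the next state, as a function of the current state.\<close>

definition gibbs_kernel ::
  "real \<Rightarrow> real \<Rightarrow> real \<Rightarrow> real \<Rightarrow> real \<Rightarrow> real \<Rightarrow> ('k::finite \<Rightarrow> nat) \<Rightarrow> ('k \<Rightarrow> nat \<Rightarrow> real) \<Rightarrow>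
   'k state \<Rightarrow> 'k state measure" where
  "gibbs_kernel a1 b1 a2 b2 m0 s0 m y s' =
     density lborel (\<lambda>s. ennreal (gibbs_density a1 b1 a2 b2 m0 s0 m y s' s))"

end

theory Submission
  imports Defs
begin

text \<open>
  Sampling \<open>\<mu>\<close> first and then the conditionally independent \<open>\<theta>\<^sub>i\<close> given \<open>\<mu>\<close> amounts to a triangular
  factor \<open>L\<close> with \<open>\<Sigma> = L L\<^sup>T\<close>, so the normal density of \<open>\<xi>\<close> splits into one-dimensional ones. With
  \<open>D\<^sub>i = \<lambda>\<^sub>\<theta> + m\<^sub>i \<lambda>\<^sub>e\<close> and \<open>t = \<lambda>\<^sub>\<theta> \<Sum>\<^sub>i (m\<^sub>i \<lambda>\<^sub>e / D\<^sub>i) = \<lambda>\<^sub>e \<Sum>\<^sub>i m\<^sub>i (\<lambda>\<^sub>\<theta> / D\<^sub>i)\<close>, squaring the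
  weights \<open>m\<^sub>i \<lambda>\<^sub>e / D\<^sub>i\<close> and \<open>\<lambda>\<^sub>\<theta> / D\<^sub>i\<close>, which lie in \<open>[0, 1]\<close>, only decreases them; hence the
  contribution of the variance \<open>1 / (s\<^sub>0 + t)\<close> of \<open>\<mu>\<close> is at most \<open>1 / \<lambda>\<^sub>\<theta>\<close> to \<open>E v\<^sub>1\<close> and
  at most \<open>1 / \<lambda>\<^sub>e\<close> to \<open>E v\<^sub>2\<close>. The conditional mean of \<open>\<mu>\<close> is a convex combination of \<open>m\<^sub>0\<close> and the
  group means, so every squared bias is at most \<open>\<Delta>\<^sup>2\<close>. It remains to integrate \<open>1 / \<lambda>\<^sub>\<theta>\<close> and
  \<open>1 / \<lambda>\<^sub>e\<close> against their gamma densities, where \<open>E (1 / \<lambda>) = \<beta> / (\<alpha> - 1)\<close>.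
\<close>

section \<open>Normal densities and a square root of the covariance matrix\<close>

text \<open>With the covariance written as L L^T, the substitution x = \<nu> + L z turns the
  quadratic form into the squared length of z, and the square root of the determinant into |det
  L|.\<close>

lemma mvnormal_density_factor:
  fixes L :: "real ^ 'n::finite ^ 'n"
  assumes "det L \<noteq> 0"
  shows "mvnormal_density \<nu> (L ** transpose L) (\<nu> + L *v z) =
           (\<Prod>i\<in>UNIV. std_normal_density (z $ i)) / \<bar>det L\<bar>"
proof -
  let ?S = "L ** transpose L"
  have L: "invertible L"
    using assms by (simp add: invertible_det_nz)
  have detS: "det ?S = (det L)\<^sup>2"
    by (simp add: det_mul det_transpose power2_eq_square)
  have S: "invertible ?S"
    using assms by (simp add: invertible_det_nz detS)
  \<comment> \<open>Cancelling L in L (L^T u) = L z leaves L^T u = z; moving L across the inner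
    product then gives (L z) . u = z . z. As \<open>matrix_inv\<close> is a choice operator, its
    defining property is recovered by \<open>someI_ex\<close>.\<close>
  define u where "u = matrix_inv ?S *v (L *v z)"
  have "?S *v u = L *v z"
    using someI_ex[OF S[unfolded invertible_def]]
    unfolding u_def matrix_vector_mul_assoc matrix_inv_def
    by (simp add: matrix_mul_assoc)
  then have "L *v (transpose L *v u) = L *v z"
    by (metis matrix_vector_mul_assoc)
  then have z: "transpose L *v u = z"
    using L by (metis invertible_def matrix_vector_mul_assoc matrix_vector_mul_lid)
  have "(L *v z) \<bullet> u = z \<bullet> z"
    by (metis z dot_lmul_matrix inner_commute transpose_matrix_vector vector_transpose_matrix)
  then have q: "(L *v z) \<bullet> (matrix_inv ?S *v (L *v z)) = (\<Sum>i\<in>UNIV. (z $ i)\<^sup>2)"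
    by (simp add: u_def inner_vec_def power2_eq_square)
  have "(\<Prod>i\<in>UNIV. std_normal_density (z $ i)) =
          exp (- (\<Sum>i\<in>UNIV. (z $ i)\<^sup>2) / 2) / sqrt (2 * pi) ^ CARD('n)"
    by (simp add: std_normal_density_def prod_dividef exp_sum[symmetric]
        sum_negf sum_divide_distrib power_divide)
  moreover have "sqrt ((2 * pi) ^ CARD('n) * det ?S) = sqrt (2 * pi) ^ CARD('n) * \<bar>det L\<bar>"
    by (simp only: detS real_sqrt_mult[of "(2 * pi) ^ CARD('n)"] real_sqrt_abs real_sqrt_power[of "2 * pi"])
  ultimately show ?thesis
    by (simp add: mvnormal_density_def q)
qed

text \<open>Encodes the sampling scheme with independent standard normal z: \<mu> is its mean plus
  z_0 / sqrt S, where S = \<open>s0 + t_sum m lt le\<close>, and \<theta>_i is its mean given \<mu>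
  plus z_i / sqrt D_i. Column \<open>None\<close> carries the noise of \<mu>, which reaches every
  coordinate; column \<open>Some i\<close> carries the noise of \<theta>_i alone.\<close>

definition xi_factor :: "('k::finite \<Rightarrow> nat) \<Rightarrow> real \<Rightarrow> real \<Rightarrow> real \<Rightarrow> real ^ 'k option ^ 'k option" where
  "xi_factor m s0 lt le = (\<chi> p q. case (p, q) of
       (None, None) \<Rightarrow> 1 / sqrt (s0 + t_sum m lt le)
     | (None, Some _) \<Rightarrow> 0
     | (Some i, None) \<Rightarrow> lt / ((lt + real (m i) * le) * sqrt (s0 + t_sum m lt le))
     | (Some i, Some j) \<Rightarrow> (if i = j then 1 / sqrt (lt + real (m i) * le) else 0))"

lemma sum_UNIV_option:
  "(\<Sum>p\<in>(UNIV :: 'k::finite option set). f p) = f None + (\<Sum>i\<in>UNIV. f (Some i))"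
  by (simp add: UNIV_option_conv sum.reindex)

lemma prod_UNIV_option:
  "(\<Prod>p\<in>(UNIV :: 'k::finite option set). f p) = f None * (\<Prod>i\<in>UNIV. f (Some i))"
  by (simp add: UNIV_option_conv prod.reindex)

text \<open>No order on \<open>'k\<close> is assumed, so triangularity is exploited through the
  permutation expansion, where only the identity survives.\<close>

lemma det_xi_factor:
  "det (xi_factor m s0 lt le) =
     1 / sqrt (s0 + t_sum m lt le) * (\<Prod>i\<in>UNIV. 1 / sqrt (lt + real (m i) * le))"
proof -
  let ?L = "xi_factor m s0 lt le"
  \<comment> \<open>Row \<open>None\<close> forces \<open>\<pi> None = None\<close>, and then injectivity leaves only the diagonal for the other rows.\<close>
  have "(\<Prod>p\<in>UNIV. ?L $ p $ \<pi> p) = 0" if \<pi>: "\<pi> permutes UNIV" "\<pi> \<noteq> id" for \<pi>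
  proof (rule ccontr)
    assume "(\<Prod>p\<in>UNIV. ?L $ p $ \<pi> p) \<noteq> 0"
    then have nz: "?L $ p $ \<pi> p \<noteq> 0" for p
      by simp
    have none: "\<pi> None = None"
      using nz[of None] by (auto simp: xi_factor_def split: option.splits)
    have "\<pi> (Some i) = Some i" for i
    proof -
      have "\<pi> (Some i) \<noteq> None"
        using permutes_inj[OF \<pi>(1)] none by (metis injD option.distinct(1))
      then show ?thesis
        using nz[of "Some i"] by (auto simp: xi_factor_def split: option.splits if_splits)
    qed
    with none have "\<pi> = id"
      by (metis eq_id_iff option.exhaust)
    with \<pi> show False by simp
  qed
  then have "det ?L = (\<Sum>\<pi>\<in>{id}. of_int (sign \<pi>) * (\<Prod>p\<in>UNIV. ?L $ p $ \<pi> p))"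
    unfolding det_def
    by (intro sum.mono_neutral_right) (auto simp: permutes_id finite_permutations)
  then show ?thesis
    by (simp add: prod_UNIV_option sign_id) (simp add: xi_factor_def)
qed

lemma t_sum_nonneg:
  assumes "lt > 0" "le > 0"
  shows "t_sum m lt le \<ge> 0"
  unfolding t_sum_def using assms by (intro sum_nonneg divide_nonneg_pos add_pos_nonneg) auto

text \<open>In the matrix product, column \<open>None\<close> yields the rank-one part common to all
  entries, and the columns \<open>Some k\<close> add 1 / D_i at the entries (\<open>Some i\<close>,
  \<open>Some i\<close>) only.\<close>

lemma xi_cov_eq_factor:
  assumes "s0 > 0" "lt > 0" "le > 0"
  shows "xi_cov m s0 lt le = xi_factor m s0 lt le ** transpose (xi_factor m s0 lt le)"
proof -
  have S: "s0 + t_sum m lt le > 0"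
    using t_sum_nonneg[of lt le m] assms by linarith
  have D: "lt + real (m i) * le > 0" for i
    using assms by (simp add: add_pos_nonneg)
  have "xi_cov m s0 lt le $ p $ q =
      (xi_factor m s0 lt le ** transpose (xi_factor m s0 lt le)) $ p $ q" for p q
  proof (cases p; cases q)
    fix i j assume pq: "p = Some i" "q = Some j"
    have "(\<Sum>k\<in>UNIV. xi_factor m s0 lt le $ Some i $ Some k * xi_factor m s0 lt le $ Some j $ Some k) =
        (\<Sum>k\<in>UNIV. if k = i then (if i = j then 1 / (lt + real (m i) * le) else 0) else 0)"
      using D[of i] by (intro sum.cong) (auto simp: xi_factor_def)
    moreover have "xi_factor m s0 lt le $ Some i $ None * xi_factor m s0 lt le $ Some j $ None =
        lt\<^sup>2 / ((lt + real (m i) * le) * (lt + real (m j) * le) * (s0 + t_sum m lt le))"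
      using S by (simp add: xi_factor_def power2_eq_square)
    ultimately have "(xi_factor m s0 lt le ** transpose (xi_factor m s0 lt le)) $ p $ q =
        lt\<^sup>2 / ((lt + real (m i) * le) * (lt + real (m j) * le) * (s0 + t_sum m lt le)) +
        (if i = j then 1 / (lt + real (m i) * le) else 0)"
      by (simp add: pq matrix_matrix_mult_def transpose_def sum_UNIV_option)
    then show ?thesis
      by (simp add: pq xi_cov_def algebra_simps power2_eq_square)
  qed (use S in \<open>auto simp: xi_cov_def xi_factor_def matrix_matrix_mult_def transpose_def
        sum_UNIV_option\<close>)
  then show ?thesis
    by (simp add: vec_eq_iff)
qed

section \<open>One-dimensional normal moments and coordinatewise integration\<close>

lemma nn_integral_normal_density:
  assumes "\<sigma> > 0"
  shows "(\<integral>\<^sup>+x. ennreal (normal_density \<nu> \<sigma> x) \<partial>lborel) = 1"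
  using assms by (subst nn_integral_eq_integral) (auto simp: integrable_normal_density)

text \<open>Expanding (x - c)^2 around \<nu> leaves the variance, a vanishing cross term and the
  squared bias.\<close>

lemma nn_integral_normal_density_square:
  assumes "\<sigma> > 0"
  shows "(\<integral>\<^sup>+x. ennreal (normal_density \<nu> \<sigma> x * (x - c)\<^sup>2) \<partial>lborel) =
           ennreal (\<sigma>\<^sup>2 + (\<nu> - c)\<^sup>2)"
proof -
  note [simp] = assms
  have 1: "has_bochner_integral lborel (\<lambda>x. normal_density \<nu> \<sigma> x * (x - \<nu>) ^ (2 * 1)) (\<sigma>\<^sup>2)"
    using normal_moment_even[of \<sigma> \<nu> 1] by simp
  have 2: "has_bochner_integral lborel (\<lambda>x. normal_density \<nu> \<sigma> x * (x - \<nu>) ^ (2 * 0 + 1)) 0"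
    using normal_moment_odd[of \<sigma> \<nu> 0] by simp
  have 3: "has_bochner_integral lborel (normal_density \<nu> \<sigma>) 1"
    by (simp add: has_bochner_integral_iff)
  have "has_bochner_integral lborel
     (\<lambda>x. normal_density \<nu> \<sigma> x * (x - \<nu>) ^ (2 * 1) +
        (2 * (\<nu> - c) * (normal_density \<nu> \<sigma> x * (x - \<nu>) ^ (2 * 0 + 1)) +
        (\<nu> - c)\<^sup>2 * normal_density \<nu> \<sigma> x))
     (\<sigma>\<^sup>2 + (2 * (\<nu> - c) * 0 + (\<nu> - c)\<^sup>2 * 1))"
    using 1 2 3 by (intro has_bochner_integral_add has_bochner_integral_mult_right) auto
  also have "(\<lambda>x. normal_density \<nu> \<sigma> x * (x - \<nu>) ^ (2 * 1) +
        (2 * (\<nu> - c) * (normal_density \<nu> \<sigma> x * (x - \<nu>) ^ (2 * 0 + 1)) +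
        (\<nu> - c)\<^sup>2 * normal_density \<nu> \<sigma> x)) = (\<lambda>x. normal_density \<nu> \<sigma> x * (x - c)\<^sup>2)"
    by (simp add: fun_eq_iff power2_eq_square algebra_simps)
  finally show ?thesis
    by (simp add: has_bochner_integral_iff nn_integral_eq_integral)
qed

lemma borel_measurable_vec_lambda:
  "vec_lambda \<in> borel_measurable (Pi\<^sub>M UNIV (\<lambda>_ :: 'n::finite. lborel :: real measure))"
  by (subst borel_measurable_euclidean_space) (auto simp: Basis_vec_def inner_axis)

text \<open>Lebesgue measure is determined by its values on boxes, and the preimage of a box under
  \<open>vec_lambda\<close> is a product of intervals. This makes Fubini available coordinate by
  coordinate.\<close>

lemma lborel_vec_eq:
  "(lborel :: (real ^ 'n::finite) measure) = distr (Pi\<^sub>M UNIV (\<lambda>_. lborel)) borel vec_lambda"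
proof (rule lborel_eqI)
  interpret product_sigma_finite "\<lambda>_ :: 'n. lborel :: real measure" ..
  fix l u :: "real ^ 'n"
  assume "\<And>b. b \<in> Basis \<Longrightarrow> l \<bullet> b \<le> u \<bullet> b"
  then have le: "l $ i \<le> u $ i" for i
    by (metis axis_in_Basis_iff cart_eq_inner_axis Basis_real_def singletonI)
  have pre: "vec_lambda -` box l u \<inter> space (Pi\<^sub>M UNIV (\<lambda>_ :: 'n. lborel :: real measure)) =
      (\<Pi>\<^sub>E i\<in>UNIV. {l $ i <..< u $ i})"
    by (auto simp: mem_box_cart space_PiM PiE_def Pi_def)
  have "emeasure (distr (Pi\<^sub>M UNIV (\<lambda>_. lborel)) borel vec_lambda) (box l u) =
      (\<Prod>i\<in>UNIV. ennreal (u $ i - l $ i))"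
    using borel_measurable_vec_lambda[where ?'n = 'n] le by (simp add: emeasure_distr pre emeasure_PiM)
  also have "\<dots> = (\<Prod>b\<in>Basis. (u - l) \<bullet> b)"
    using le by (simp add: prod_ennreal Basis_vec_def cart_eq_inner_axis[symmetric] UNION_singleton_eq_range
        prod.reindex inj_on_def axis_eq_axis)
  finally show "emeasure (distr (Pi\<^sub>M UNIV (\<lambda>_. lborel)) borel vec_lambda) (box l u) =
      (\<Prod>b\<in>Basis. (u - l) \<bullet> b)" .
qed simp

text \<open>Expectation of a sum of functions of independent coordinates: in the i-th summand every
  factor but the i-th integrates to 1.\<close>

lemma (in product_sigma_finite) nn_integral_PiM_sum_times_prod:
  assumes fin: "finite I"
    and p[measurable]: "\<And>i. i \<in> I \<Longrightarrow> p i \<in> borel_measurable (M i)"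
    and q[measurable]: "\<And>i. i \<in> I \<Longrightarrow> q i \<in> borel_measurable (M i)"
    and one: "\<And>i. i \<in> I \<Longrightarrow> (\<integral>\<^sup>+x. p i x \<partial>M i) = (1 :: ennreal)"
  shows "(\<integral>\<^sup>+x. (\<Sum>i\<in>I. q i (x i)) * (\<Prod>i\<in>I. p i (x i)) \<partial>Pi\<^sub>M I M) =
           (\<Sum>i\<in>I. \<integral>\<^sup>+x. q i x * p i x \<partial>M i)"
proof -
  \<comment> \<open>\<open>r i j\<close> is the j-th factor of the i-th summand; absorbing
    \<open>q i\<close> into the factor j = i makes each summand a pure product.\<close>
  define r where "r i j x = (if j = i then q j x else 1) * p j x" for i j x
  have r[measurable]: "r i j \<in> borel_measurable (M j)" if "j \<in> I" for i j
    unfolding r_def using that by auto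
  have "(\<Sum>i\<in>I. q i (x i)) * (\<Prod>i\<in>I. p i (x i)) = (\<Sum>i\<in>I. \<Prod>j\<in>I. r i j (x j))" for x
    using fin by (simp add: sum_distrib_right r_def prod.distrib prod.delta)
  then have "(\<integral>\<^sup>+x. (\<Sum>i\<in>I. q i (x i)) * (\<Prod>i\<in>I. p i (x i)) \<partial>Pi\<^sub>M I M) =
      (\<Sum>i\<in>I. \<integral>\<^sup>+x. (\<Prod>j\<in>I. r i j (x j)) \<partial>Pi\<^sub>M I M)"
    using fin by (simp add: nn_integral_sum)
  also have "\<dots> = (\<Sum>i\<in>I. \<Prod>j\<in>I. \<integral>\<^sup>+x. r i j x \<partial>M j)"
    using fin by (intro sum.cong refl product_nn_integral_prod) auto
  also have "\<dots> = (\<Sum>i\<in>I. \<Prod>j\<in>I. if j = i then \<integral>\<^sup>+x. q j x * p j x \<partial>M j else 1)"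
    using one by (intro sum.cong prod.cong) (auto simp: r_def)
  also have "\<dots> = (\<Sum>i\<in>I. \<integral>\<^sup>+x. q i x * p i x \<partial>M i)"
    using fin by (simp add: prod.delta)
  finally show ?thesis .
qed

section \<open>Gamma densities and their inverse moments\<close>

text \<open>Substitute t = \<beta> w in the integral for \<open>Gamma\<close>.\<close>

lemma nn_integral_gamma_density:
  assumes "\<alpha> > 0" "\<beta> > 0"
  shows "(\<integral>\<^sup>+w. ennreal (gamma_density \<alpha> \<beta> w) \<partial>lborel) = 1"
proof -
  have G: "Gamma \<alpha> > 0"
    using assms by (simp add: Gamma_real_pos)
  have "ennreal (Gamma \<alpha>) = (\<integral>\<^sup>+t. ennreal (indicator {0..} t * t powr (\<alpha> - 1) / exp t) \<partial>lborel)"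
    using Gamma_conv_nn_integral_real assms(1) .
  also have "\<dots> = ennreal \<beta> *
      (\<integral>\<^sup>+w. ennreal (indicator {0..} (0 + \<beta> * w) * (0 + \<beta> * w) powr (\<alpha> - 1) / exp (0 + \<beta> * w)) \<partial>lborel)"
    using assms by (subst nn_integral_real_affine[where c = \<beta> and t = 0]) auto
  also have "\<dots> = (\<integral>\<^sup>+w. ennreal (Gamma \<alpha>) * ennreal (gamma_density \<alpha> \<beta> w) \<partial>lborel)"
  proof (subst nn_integral_cmult[symmetric], simp, intro nn_integral_cong)
    fix w :: real
    show "ennreal \<beta> * ennreal (indicator {0..} (0 + \<beta> * w) * (0 + \<beta> * w) powr (\<alpha> - 1) / exp (0 + \<beta> * w)) =
        ennreal (Gamma \<alpha>) * ennreal (gamma_density \<alpha> \<beta> w)"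
    proof (cases "w > 0")
      case True
      have "\<beta> * (\<beta> * w) powr (\<alpha> - 1) = \<beta> powr \<alpha> * w powr (\<alpha> - 1)"
        using assms True by (simp add: powr_mult powr_diff)
      then show ?thesis
        using True assms G
        by (simp add: gamma_density_def ennreal_mult[symmetric] exp_minus field_simps less_imp_neq[THEN not_sym])
    next
      \<comment> \<open>At w = 0 the indicator is 1, but \<open>0 powr (\<alpha> - 1)\<close> is 0
        for every exponent, so the integrand vanishes there just as \<open>gamma_density\<close>
        does.\<close>
      case False
      then show ?thesis
        using assms by (cases "w = 0") (auto simp: gamma_density_def indicator_def zero_le_mult_iff)
    qed
  qed
  also have "\<dots> = ennreal (Gamma \<alpha>) * (\<integral>\<^sup>+w. ennreal (gamma_density \<alpha> \<beta> w) \<partial>lborel)"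
    unfolding gamma_density_def by (rule nn_integral_cmult) measurable
  finally show ?thesis
    using G by (metis ennreal_mult_cancel_left ennreal_neq_top ennreal_eq_0_iff mult.right_neutral not_le)
qed

text \<open>Dividing by w lowers the shape by one, and the recursion of \<open>Gamma\<close>
  supplies the constant. The inverse moment thus becomes the total mass of another gamma
  density.\<close>

lemma gamma_density_divide:
  assumes "\<alpha> > 1" "\<beta> > 0"
  shows "gamma_density \<alpha> \<beta> w / w = \<beta> / (\<alpha> - 1) * gamma_density (\<alpha> - 1) \<beta> w"
proof (cases "w > 0")
  case True
  have "Gamma \<alpha> = (\<alpha> - 1) * Gamma (\<alpha> - 1)"
    using Gamma_plus1[of "\<alpha> - 1"] assms by (auto simp: nonpos_Ints_def)
  moreover have "\<beta> powr \<alpha> = \<beta> * \<beta> powr (\<alpha> - 1)" "w powr (\<alpha> - 1) = w * w powr (\<alpha> - 1 - 1)"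
    using assms True by (simp_all add: powr_diff power2_eq_square)
  ultimately show ?thesis
    using True by (simp add: gamma_density_def)
qed (simp add: gamma_density_def)

lemma gamma_density_nonneg: "\<alpha> > 0 \<Longrightarrow> gamma_density \<alpha> \<beta> w \<ge> 0"
  by (simp add: gamma_density_def Gamma_real_pos less_imp_le)

lemma borel_measurable_gamma_density [measurable]: "gamma_density \<alpha> \<beta> \<in> borel_measurable borel"
  unfolding gamma_density_def[abs_def] by measurable

lemma nn_integral_gamma_density_inverse:
  assumes "\<alpha> > 1" "\<beta> > 0"
  shows "(\<integral>\<^sup>+w. ennreal (gamma_density \<alpha> \<beta> w / w) \<partial>lborel) = ennreal (\<beta> / (\<alpha> - 1))"
proof -
  have "(\<integral>\<^sup>+w. ennreal (gamma_density \<alpha> \<beta> w / w) \<partial>lborel) =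
      (\<integral>\<^sup>+w. ennreal (\<beta> / (\<alpha> - 1)) * ennreal (gamma_density (\<alpha> - 1) \<beta> w) \<partial>lborel)"
    using assms by (intro nn_integral_cong)
      (simp add: gamma_density_divide ennreal_mult[symmetric] gamma_density_nonneg)
  then show ?thesis
    using assms by (simp add: nn_integral_cmult nn_integral_gamma_density)
qed

section \<open>Sequential form of the normal law of \<xi>\<close>

lemma normal_density_eq_std:
  assumes "r > 0"
  shows "normal_density a (1 / sqrt r) x = sqrt r * std_normal_density (sqrt r * (x - a))"
proof -
  have "(sqrt r * (x - a))\<^sup>2 = r * (x - a)\<^sup>2"
    using assms by (simp add: power_mult_distrib)
  then show ?thesis
    using assms by (simp add: normal_density_def power_divide real_sqrt_divide real_sqrt_mult)
qed

text \<open>The joint law is that of \<mu> with precision S followed by independent \<theta>_i with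
  precision D_i, centred at a convex combination of \<mu> and the group mean. It follows by
  standardising \<xi> through \<open>xi_factor\<close>.\<close>

lemma mvnormal_density_xi:
  fixes m :: "'k::finite \<Rightarrow> nat"
  assumes "s0 > 0" "lt > 0" "le > 0"
  shows "mvnormal_density (xi_mean m y m0 s0 lt le) (xi_cov m s0 lt le) \<xi> =
     normal_density (mu_mean m y m0 s0 lt le) (1 / sqrt (s0 + t_sum m lt le)) (\<xi> $ None) *
     (\<Prod>i\<in>UNIV. normal_density
        ((lt * \<xi> $ None + real (m i) * le * ybar m y i) / (lt + real (m i) * le))
        (1 / sqrt (lt + real (m i) * le)) (\<xi> $ Some i))"
proof -
  let ?L = "xi_factor m s0 lt le" and ?\<eta> = "mu_mean m y m0 s0 lt le"
  define S where "S = s0 + t_sum m lt le"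
  define D where "D i = lt + real (m i) * le" for i
  define a where "a i = (lt * \<xi> $ None + real (m i) * le * ybar m y i) / D i" for i
  have S: "S > 0"
    using t_sum_nonneg[of lt le m] assms by (simp add: S_def)
  have D: "D i > 0" for i
    using assms by (simp add: D_def add_pos_nonneg)
  have L: "det ?L > 0"
    using S D by (simp add: det_xi_factor S_def D_def prod_pos)
  \<comment> \<open>Forward substitution for mean + L z = \<xi>: first \<mu> is standardised, then
    each \<theta>_i around \<open>a i\<close>, which involves the actual \<mu> and not its
    mean.\<close>
  define z where "z = (\<chi> p. case p of None \<Rightarrow> sqrt S * (\<xi> $ None - ?\<eta>)
      | Some i \<Rightarrow> sqrt (D i) * (\<xi> $ Some i - a i))"
  have "(xi_mean m y m0 s0 lt le + ?L *v z) $ p = \<xi> $ p" for p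
  proof (cases p)
    case None
    then show ?thesis
      using S by (simp add: xi_mean_def matrix_vector_mult_def sum_UNIV_option xi_factor_def z_def
          flip: S_def D_def)
  next
    case (Some i)
    have "(\<Sum>j\<in>UNIV. ?L $ Some i $ Some j * z $ Some j) = (\<Sum>j\<in>UNIV. if j = i then \<xi> $ Some i - a i else 0)"
      using D[of i] by (intro sum.cong) (auto simp: xi_factor_def z_def simp flip: D_def)
    moreover have "?L $ Some i $ None * z $ None = lt * (\<xi> $ None - ?\<eta>) / D i"
      using S by (simp add: xi_factor_def z_def flip: S_def D_def)
    ultimately show ?thesis
      by (simp add: Some xi_mean_def matrix_vector_mult_def sum_UNIV_option a_def right_diff_distrib
          add_divide_distrib diff_divide_distrib flip: D_def)
  qed
  then have \<xi>: "xi_mean m y m0 s0 lt le + ?L *v z = \<xi>"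
    by (simp add: vec_eq_iff)
  have "mvnormal_density (xi_mean m y m0 s0 lt le) (xi_cov m s0 lt le) \<xi> =
      (\<Prod>p\<in>UNIV. std_normal_density (z $ p)) / det ?L"
    using mvnormal_density_factor[of ?L "xi_mean m y m0 s0 lt le" z] L
    by (simp add: \<xi> xi_cov_eq_factor assms)
  \<comment> \<open>Dividing by det L hands a factor sqrt S or sqrt D_i to each coordinate, as its
    standardisation requires.\<close>
  also have "\<dots> = sqrt S * std_normal_density (z $ None) *
      (\<Prod>i\<in>UNIV. sqrt (D i) * std_normal_density (z $ Some i))"
    by (simp add: prod_UNIV_option det_xi_factor prod.distrib prod_dividef flip: S_def D_def)
  also have "\<dots> = normal_density ?\<eta> (1 / sqrt S) (\<xi> $ None) *
      (\<Prod>i\<in>UNIV. normal_density (a i) (1 / sqrt (D i)) (\<xi> $ Some i))"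
    using S D by (simp add: normal_density_eq_std z_def)
  finally show ?thesis
    by (simp add: a_def S_def D_def)
qed

text \<open>The coordinate \<mu> is outermost because the densities of the \<theta>_i depend on it.
  The other coordinates keep the index set \<open>range Some\<close>, since \<open>UNIV\<close> is
  \<open>insert None (range Some)\<close>.\<close>

lemma nn_integral_lborel_option:
  fixes f :: "real ^ 'k::finite option \<Rightarrow> ennreal"
  assumes [measurable]: "f \<in> borel_measurable borel"
  shows "(\<integral>\<^sup>+\<xi>. f \<xi> \<partial>lborel) =
    (\<integral>\<^sup>+u. (\<integral>\<^sup>+x. f (\<chi> p. case p of None \<Rightarrow> u | Some i \<Rightarrow> x (Some i)) \<partial>Pi\<^sub>M (range Some) (\<lambda>_. lborel)) \<partial>lborel)"
proof -
  interpret product_sigma_finite "\<lambda>_ :: 'k option. lborel :: real measure" ..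
  note [measurable] = borel_measurable_vec_lambda
  have "(\<integral>\<^sup>+\<xi>. f \<xi> \<partial>lborel) = (\<integral>\<^sup>+x. f (vec_lambda x) \<partial>Pi\<^sub>M UNIV (\<lambda>_. lborel))"
    by (subst lborel_vec_eq) (simp add: nn_integral_distr)
  also have "\<dots> = (\<integral>\<^sup>+u. (\<integral>\<^sup>+x. f (vec_lambda (x(None := u))) \<partial>Pi\<^sub>M (range Some) (\<lambda>_. lborel)) \<partial>lborel)"
    using borel_measurable_vec_lambda[where ?'n = "'k option"] unfolding UNIV_option_conv
    by (intro product_nn_integral_insert_rev) auto
  also have "\<dots> =
      (\<integral>\<^sup>+u. (\<integral>\<^sup>+x. f (\<chi> p. case p of None \<Rightarrow> u | Some i \<Rightarrow> x (Some i)) \<partial>Pi\<^sub>M (range Some) (\<lambda>_. lborel)) \<partial>lborel)"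
    by (intro nn_integral_cong arg_cong[where f = f]) (auto simp: vec_eq_iff split: option.splits)
  finally show ?thesis .
qed

section \<open>Expectation of the drift function given \<lambda>\<close>

text \<open>Variance plus squared bias is applied twice: to \<theta>_i with \<mu> fixed, then to
  \<mu> around \<eta>. The value is exact; all estimates come later.\<close>

lemma nn_integral_drift_xi:
  fixes m :: "'k::finite \<Rightarrow> nat" and y :: "'k \<Rightarrow> nat \<Rightarrow> real" and m0 :: real
  assumes pos: "s0 > 0" "lt > 0" "le > 0" and \<phi>: "\<phi>1 \<ge> 0" "\<phi>2 \<ge> 0"
  defines "S \<equiv> s0 + t_sum m lt le" and "D \<equiv> \<lambda>i. lt + real (m i) * le"
    and "\<eta> \<equiv> mu_mean m y m0 s0 lt le"
  shows "(\<integral>\<^sup>+\<xi>. ennreal (mvnormal_density (xi_mean m y m0 s0 lt le) (xi_cov m s0 lt le) \<xi> *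
            (\<phi>1 * v1 (theta_of \<xi>) (mu_of \<xi>) + \<phi>2 * v2 m y (theta_of \<xi>))) \<partial>lborel) =
     ennreal (\<Sum>i\<in>UNIV.
        \<phi>1 * (1 / D i + (real (m i) * le / D i)\<^sup>2 * (1 / S + (\<eta> - ybar m y i)\<^sup>2)) +
        \<phi>2 * real (m i) * (1 / D i + (lt / D i)\<^sup>2 * (1 / S + (\<eta> - ybar m y i)\<^sup>2)))"
    (is "?lhs = _")
proof -
  have S: "S > 0"
    using t_sum_nonneg[of lt le m] pos by (simp add: S_def)
  have D: "D i > 0" for i
    using pos by (simp add: D_def add_pos_nonneg)
  define a where "a i u = (lt * u + real (m i) * le * ybar m y i) / D i" for i u
  define n where "n i u = normal_density (a i u) (1 / sqrt (D i))" for i u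
  define q where "q i u x = \<phi>1 * (x - u)\<^sup>2 + \<phi>2 * real (m i) * (x - ybar m y i)\<^sup>2" for i u x
  define n0 where "n0 = normal_density \<eta> (1 / sqrt S)"
  \<comment> \<open>\<open>C i\<close> is the coefficient of the squared distance from \<mu> to the
    i-th group mean that remains once \<theta>_i is integrated out.\<close>
  define C where "C i = \<phi>1 * (real (m i) * le / D i)\<^sup>2 + \<phi>2 * real (m i) * (lt / D i)\<^sup>2" for i
  have q0: "q i u x \<ge> 0" for i u x
    using \<phi> by (simp add: q_def)
  have n_nn: "n i u x \<ge> 0" "n0 x \<ge> 0" for i u x
    by (simp_all add: n_def n0_def)
  have C0: "C i \<ge> 0" for i
    using \<phi> by (simp add: C_def)
  have [measurable]: "(\<lambda>\<xi>. \<xi> $ p) \<in> borel_measurable borel" for p :: "'k option"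
    by (intro borel_measurable_continuous_onI continuous_intros)
  have [measurable]: "(\<lambda>x. n i (f x) (g x)) \<in> borel_measurable M"
      "(\<lambda>x. n0 (g x)) \<in> borel_measurable M" "(\<lambda>x. q i (f x) (g x)) \<in> borel_measurable M"
    if [measurable]: "f \<in> borel_measurable M" "g \<in> borel_measurable M" for f g i and M :: "'z measure"
    unfolding n_def n0_def q_def a_def normal_density_def by measurable
  interpret product_sigma_finite "\<lambda>_ :: 'k option. lborel :: real measure" ..
  have "?lhs = (\<integral>\<^sup>+\<xi>. ennreal (n0 (\<xi> $ None)) * ((\<Sum>i\<in>UNIV. ennreal (q i (\<xi> $ None) (\<xi> $ Some i))) *
      (\<Prod>i\<in>UNIV. ennreal (n i (\<xi> $ None) (\<xi> $ Some i)))) \<partial>lborel)"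
  proof (intro nn_integral_cong)
    fix \<xi> :: "real ^ 'k option"
    have "mvnormal_density (xi_mean m y m0 s0 lt le) (xi_cov m s0 lt le) \<xi> =
        n0 (\<xi> $ None) * (\<Prod>i\<in>UNIV. n i (\<xi> $ None) (\<xi> $ Some i))"
      by (simp only: mvnormal_density_xi[OF pos] n0_def n_def a_def S_def D_def \<eta>_def)
    moreover have "\<phi>1 * v1 (theta_of \<xi>) (mu_of \<xi>) + \<phi>2 * v2 m y (theta_of \<xi>) =
        (\<Sum>i\<in>UNIV. q i (\<xi> $ None) (\<xi> $ Some i))"
      by (simp add: v1_def v2_def theta_of_def mu_of_def q_def sum_distrib_left sum.distrib mult.assoc)
    ultimately show "ennreal (mvnormal_density (xi_mean m y m0 s0 lt le) (xi_cov m s0 lt le) \<xi> *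
            (\<phi>1 * v1 (theta_of \<xi>) (mu_of \<xi>) + \<phi>2 * v2 m y (theta_of \<xi>))) =
        ennreal (n0 (\<xi> $ None)) * ((\<Sum>i\<in>UNIV. ennreal (q i (\<xi> $ None) (\<xi> $ Some i))) *
          (\<Prod>i\<in>UNIV. ennreal (n i (\<xi> $ None) (\<xi> $ Some i))))"
      by (simp only: sum_ennreal[OF q0] prod_ennreal[OF n_nn(1)])
         (simp add: ennreal_mult[symmetric] sum_nonneg prod_nonneg q0 n_nn mult_ac)
  qed
  also have "\<dots> = (\<integral>\<^sup>+u. (\<integral>\<^sup>+x. ennreal (n0 u) * ((\<Sum>p\<in>range Some. ennreal (q (the p) u (x p))) *
      (\<Prod>p\<in>range Some. ennreal (n (the p) u (x p)))) \<partial>Pi\<^sub>M (range Some) (\<lambda>_. lborel)) \<partial>lborel)"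
    by (subst nn_integral_lborel_option) (simp_all add: sum.reindex prod.reindex)
  also have "\<dots> = (\<integral>\<^sup>+u. ennreal (n0 u) * (\<integral>\<^sup>+x. (\<Sum>p\<in>range Some. ennreal (q (the p) u (x p))) *
      (\<Prod>p\<in>range Some. ennreal (n (the p) u (x p))) \<partial>Pi\<^sub>M (range Some) (\<lambda>_. lborel)) \<partial>lborel)"
    by (intro nn_integral_cong nn_integral_cmult) measurable
  \<comment> \<open>Given \<mu> = u the \<theta>_i are independent, so the integral of the sum
    reduces to one-dimensional ones.\<close>
  also have "\<dots> = (\<integral>\<^sup>+u. ennreal (n0 u) * (\<Sum>p\<in>range Some. \<integral>\<^sup>+x. ennreal (q (the p) u x) *
      ennreal (n (the p) u x) \<partial>lborel) \<partial>lborel)"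
    using D by (intro nn_integral_cong arg_cong2[where f = "(*)"] refl nn_integral_PiM_sum_times_prod)
      (auto simp: n_def nn_integral_normal_density)
  also have "\<dots> = (\<integral>\<^sup>+u. ennreal (n0 u) * (\<Sum>i\<in>UNIV. \<integral>\<^sup>+x. ennreal (q i u x) *
      ennreal (n i u x) \<partial>lborel) \<partial>lborel)"
    by (simp add: sum.reindex)
  also have "\<dots> = (\<integral>\<^sup>+u. ennreal (n0 u) * (\<Sum>i\<in>UNIV. ennreal ((\<phi>1 + \<phi>2 * real (m i)) / D i +
      C i * (u - ybar m y i)\<^sup>2)) \<partial>lborel)"
  proof (intro nn_integral_cong arg_cong2[where f = "(*)"] refl sum.cong)
    fix u i
    have "(\<integral>\<^sup>+x. ennreal (q i u x) * ennreal (n i u x) \<partial>lborel) =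
        (\<integral>\<^sup>+x. ennreal \<phi>1 * ennreal (n i u x * (x - u)\<^sup>2) +
          ennreal (\<phi>2 * real (m i)) * ennreal (n i u x * (x - ybar m y i)\<^sup>2) \<partial>lborel)"
      using \<phi> by (intro nn_integral_cong)
        (simp add: ennreal_mult[symmetric] ennreal_plus[symmetric] q0 n_nn q_def algebra_simps del: ennreal_plus)
    also have "\<dots> = ennreal \<phi>1 * ennreal (1 / D i + (a i u - u)\<^sup>2) +
          ennreal (\<phi>2 * real (m i)) * ennreal (1 / D i + (a i u - ybar m y i)\<^sup>2)"
      using D[of i] by (simp add: nn_integral_add nn_integral_cmult)
        (simp add: n_def nn_integral_normal_density_square power_divide)
    also have "\<dots> = ennreal (\<phi>1 * (1 / D i + (a i u - u)\<^sup>2) +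
          \<phi>2 * real (m i) * (1 / D i + (a i u - ybar m y i)\<^sup>2))"
      using \<phi> D[of i] by (simp add: ennreal_mult[symmetric] ennreal_plus[symmetric] del: ennreal_plus)
    \<comment> \<open>\<open>a i u\<close> has weights \<open>lt / D i\<close> on u and
      \<open>real (m i) * le / D i\<close> on the group mean, so its distance to either point is the
      weight of the other times their distance.\<close>
    also have "a i u - u = (real (m i) * le / D i) * (ybar m y i - u)"
      using D[of i] by (simp add: a_def field_simps) (simp add: D_def algebra_simps)
    also have "a i u - ybar m y i = (lt / D i) * (u - ybar m y i)"
      using D[of i] by (simp add: a_def field_simps) (simp add: D_def algebra_simps)
    also have "\<phi>1 * (1 / D i + (real (m i) * le / D i * (ybar m y i - u))\<^sup>2) +
        \<phi>2 * real (m i) * (1 / D i + (lt / D i * (u - ybar m y i))\<^sup>2) =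
        (\<phi>1 + \<phi>2 * real (m i)) / D i + C i * (u - ybar m y i)\<^sup>2"
      unfolding C_def power_mult_distrib power2_commute[of "ybar m y i" u]
      by (simp add: algebra_simps add_divide_distrib)
    finally show "(\<integral>\<^sup>+x. ennreal (q i u x) * ennreal (n i u x) \<partial>lborel) =
        ennreal ((\<phi>1 + \<phi>2 * real (m i)) / D i + C i * (u - ybar m y i)\<^sup>2)" .
  qed
  also have "\<dots> = (\<integral>\<^sup>+u. (\<Sum>i\<in>UNIV. ennreal ((\<phi>1 + \<phi>2 * real (m i)) / D i) * ennreal (n0 u) +
      ennreal (C i) * ennreal (n0 u * (u - ybar m y i)\<^sup>2)) \<partial>lborel)"
    using \<phi> D unfolding sum_distrib_left by (intro nn_integral_cong sum.cong refl)
      (simp add: ennreal_mult[symmetric] ennreal_plus[symmetric] C0 n_nn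
        less_imp_le algebra_simps del: ennreal_plus)
  also have "\<dots> = (\<Sum>i\<in>UNIV. ennreal ((\<phi>1 + \<phi>2 * real (m i)) / D i) +
      ennreal (C i) * ennreal (1 / S + (\<eta> - ybar m y i)\<^sup>2))"
    using S by (simp add: nn_integral_sum nn_integral_add nn_integral_cmult)
      (simp add: n0_def nn_integral_normal_density nn_integral_normal_density_square power_divide)
  also have "\<dots> = ennreal (\<Sum>i\<in>UNIV. (\<phi>1 + \<phi>2 * real (m i)) / D i + C i * (1 / S + (\<eta> - ybar m y i)\<^sup>2))"
    using S D \<phi> by (subst sum_ennreal[symmetric])
      (simp_all add: ennreal_mult[symmetric] ennreal_plus[symmetric] C0 less_imp_le del: ennreal_plus)
  also have "(\<Sum>i\<in>UNIV. (\<phi>1 + \<phi>2 * real (m i)) / D i + C i * (1 / S + (\<eta> - ybar m y i)\<^sup>2)) =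
      (\<Sum>i\<in>UNIV. \<phi>1 * (1 / D i + (real (m i) * le / D i)\<^sup>2 * (1 / S + (\<eta> - ybar m y i)\<^sup>2)) +
        \<phi>2 * real (m i) * (1 / D i + (lt / D i)\<^sup>2 * (1 / S + (\<eta> - ybar m y i)\<^sup>2)))"
    by (simp add: C_def algebra_simps add_divide_distrib)
  finally show ?thesis .
qed

section \<open>Bounds on variances and biases\<close>

text \<open>The bound is affine in 1 / \<open>lt\<close> and 1 / \<open>le\<close>, ready for the
  gamma integrals. The term 1 / \<open>lt\<close> comes from the variance of \<mu> alone, since the
  variances 1 / D_i are all charged to 1 / \<open>le\<close>.\<close>

lemma drift_sum_le:
  fixes m :: "'k::finite \<Rightarrow> nat" and \<eta> :: real and yb :: "'k \<Rightarrow> real"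
  assumes pos: "s0 > 0" "lt > 0" "le > 0" and m: "\<And>i. m i > 0" and \<phi>: "\<phi>1 \<ge> 0" "\<phi>2 \<ge> 0"
    and \<Delta>: "\<And>i. \<bar>\<eta> - yb i\<bar> \<le> \<Delta>"
  defines "S \<equiv> s0 + t_sum m lt le" and "D \<equiv> \<lambda>i. lt + real (m i) * le"
  shows "(\<Sum>i\<in>UNIV.
        \<phi>1 * (1 / D i + (real (m i) * le / D i)\<^sup>2 * (1 / S + (\<eta> - yb i)\<^sup>2)) +
        \<phi>2 * real (m i) * (1 / D i + (lt / D i)\<^sup>2 * (1 / S + (\<eta> - yb i)\<^sup>2))) \<le>
     \<phi>1 * (1 / lt + (\<Sum>i\<in>UNIV. 1 / real (m i)) / le + real CARD('k) * \<Delta>\<^sup>2) +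
     \<phi>2 * ((real CARD('k) + 1) / le + real (\<Sum>i\<in>UNIV. m i) * \<Delta>\<^sup>2)"
proof -
  have S: "S > 0" and tS: "t_sum m lt le \<le> S"
    using t_sum_nonneg[of lt le m] pos by (simp_all add: S_def)
  have D: "D i > 0" for i
    using pos by (simp add: D_def add_pos_nonneg)
  define x where "x i = real (m i) * le / D i" for i
  define w where "w i = lt / D i" for i
  have x: "0 \<le> x i" "x i \<le> 1" and w: "0 \<le> w i" "w i \<le> 1" for i
    using D[of i] pos by (simp_all add: x_def w_def) (simp_all add: D_def)
  have sq: "u\<^sup>2 \<le> u" if "0 \<le> u" "u \<le> 1" for u :: real
    using that by (simp add: power2_eq_square mult_left_le)
  have dsq: "(\<eta> - yb i)\<^sup>2 \<le> \<Delta>\<^sup>2" for i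
    using \<Delta>[of i] by (simp add: abs_le_square_iff[symmetric])
  have sq\<Delta>: "u\<^sup>2 * (\<eta> - yb i)\<^sup>2 \<le> \<Delta>\<^sup>2" if "0 \<le> u" "u \<le> 1" for u i
    using mult_mono[of "u\<^sup>2" 1 "(\<eta> - yb i)\<^sup>2" "\<Delta>\<^sup>2"] dsq[of i] that by (simp add: power_le_one)
  have tx: "t_sum m lt le = lt * (\<Sum>i\<in>UNIV. x i)"
    by (simp add: t_sum_def x_def D_def sum_distrib_left mult_ac)
  have tw: "t_sum m lt le = le * (\<Sum>i\<in>UNIV. real (m i) * w i)"
    by (simp add: t_sum_def w_def D_def sum_distrib_left mult_ac)
  have "(\<Sum>i\<in>UNIV. (x i)\<^sup>2) \<le> S / lt"
  proof -
    have "(\<Sum>i\<in>UNIV. (x i)\<^sup>2) \<le> (\<Sum>i\<in>UNIV. x i)"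
      by (intro sum_mono sq x)
    also have "\<dots> \<le> S / lt"
      using tS pos unfolding tx by (simp add: field_simps)
    finally show ?thesis .
  qed
  then have 1: "(\<Sum>i\<in>UNIV. (x i)\<^sup>2) / S \<le> 1 / lt"
    using S pos by (simp add: field_simps)
  have "(\<Sum>i\<in>UNIV. real (m i) * (w i)\<^sup>2) \<le> S / le"
  proof -
    have "(\<Sum>i\<in>UNIV. real (m i) * (w i)\<^sup>2) \<le> (\<Sum>i\<in>UNIV. real (m i) * w i)"
      by (intro sum_mono mult_left_mono sq w) auto
    also have "\<dots> \<le> S / le"
      using tS pos unfolding tw by (simp add: field_simps)
    finally show ?thesis .
  qed
  then have 2: "(\<Sum>i\<in>UNIV. real (m i) * (w i)\<^sup>2) / S \<le> 1 / le"
    using S pos by (simp add: field_simps)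
  have 3: "(\<Sum>i\<in>UNIV. 1 / D i) \<le> (\<Sum>i\<in>UNIV. 1 / real (m i)) / le"
    unfolding sum_divide_distrib
  proof (intro sum_mono)
    fix i
    have "1 / D i \<le> 1 / (real (m i) * le)"
      using pos m[of i] by (intro divide_left_mono) (auto simp: D_def add_pos_pos)
    then show "1 / D i \<le> 1 / real (m i) / le"
      by simp
  qed
  \<comment> \<open>As in bound 3, \<open>lt\<close> is dropped from D_i. The K / \<open>le\<close>
    obtained here and the 1 / \<open>le\<close> of bound 2 add up to the factor K + 1.\<close>
  have 4: "(\<Sum>i\<in>UNIV. real (m i) / D i) \<le> real CARD('k) / le"
  proof -
    have "(\<Sum>i\<in>UNIV. real (m i) / D i) \<le> (\<Sum>i\<in>(UNIV :: 'k set). 1 / le)"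
      using D pos by (intro sum_mono) (simp add: field_simps, simp add: D_def algebra_simps)
    then show ?thesis by simp
  qed
  have 5: "(\<Sum>i\<in>UNIV. (x i)\<^sup>2 * (\<eta> - yb i)\<^sup>2) \<le> real CARD('k) * \<Delta>\<^sup>2"
    using sum_mono[of UNIV "\<lambda>i. (x i)\<^sup>2 * (\<eta> - yb i)\<^sup>2" "\<lambda>_. \<Delta>\<^sup>2"] sq\<Delta> x by simp
  have 6: "(\<Sum>i\<in>UNIV. real (m i) * ((w i)\<^sup>2 * (\<eta> - yb i)\<^sup>2)) \<le> real (\<Sum>i\<in>UNIV. m i) * \<Delta>\<^sup>2"
    using sum_mono[of UNIV "\<lambda>i. real (m i) * ((w i)\<^sup>2 * (\<eta> - yb i)\<^sup>2)" "\<lambda>i. real (m i) * \<Delta>\<^sup>2"] sq\<Delta> w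
    by (simp add: sum_distrib_right mult_left_mono)
  have "(\<Sum>i\<in>UNIV.
        \<phi>1 * (1 / D i + (x i)\<^sup>2 * (1 / S + (\<eta> - yb i)\<^sup>2)) +
        \<phi>2 * real (m i) * (1 / D i + (w i)\<^sup>2 * (1 / S + (\<eta> - yb i)\<^sup>2))) =
     \<phi>1 * ((\<Sum>i\<in>UNIV. 1 / D i) + (\<Sum>i\<in>UNIV. (x i)\<^sup>2) / S + (\<Sum>i\<in>UNIV. (x i)\<^sup>2 * (\<eta> - yb i)\<^sup>2)) +
     \<phi>2 * ((\<Sum>i\<in>UNIV. real (m i) / D i) + (\<Sum>i\<in>UNIV. real (m i) * (w i)\<^sup>2) / S +
        (\<Sum>i\<in>UNIV. real (m i) * ((w i)\<^sup>2 * (\<eta> - yb i)\<^sup>2)))"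
    by (simp add: sum_distrib_left sum_divide_distrib sum.distrib algebra_simps)
  also have "\<dots> \<le> \<phi>1 * (1 / lt + (\<Sum>i\<in>UNIV. 1 / real (m i)) / le + real CARD('k) * \<Delta>\<^sup>2) +
     \<phi>2 * ((real CARD('k) + 1) / le + real (\<Sum>i\<in>UNIV. m i) * \<Delta>\<^sup>2)"
    using 1 2 3 4 5 6 \<phi> unfolding add_divide_distrib
    by (intro add_mono[OF mult_left_mono mult_left_mono]) linarith+
  finally show ?thesis
    by (simp only: x_def w_def)
qed

text \<open>The hull contains the interval between the two points. Its compactness supplies the
  finite measure that monotonicity of \<open>measure\<close> relies on.\<close>

lemma abs_diff_le_length_convex_hull:
  fixes F :: "real set"
  assumes "finite F" "p \<in> convex hull F" "q \<in> convex hull F"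
  shows "\<bar>p - q\<bar> \<le> measure lborel (convex hull F)"
proof -
  have "compact (convex hull F)"
    using assms by (intro compact_convex_hull finite_imp_compact)
  moreover have "{min p q..max p q} \<subseteq> convex hull F"
    using assms closed_segment_subset[OF assms(2,3) convex_convex_hull]
    by (simp add: closed_segment_eq_real_ivl min_def max_def split: if_splits)
  ultimately have "measure lborel {min p q..max p q} \<le> measure lborel (convex hull F)"
    by (intro measure_mono_fmeasurable fmeasurable_compact) auto
  then show ?thesis
    by (simp add: min_def max_def split: if_splits)
qed

text \<open>The weights are s0 / S on m0 and m_i \<open>lt\<close> \<open>le\<close> / (D_i S) on
  the group means; they sum to 1 by the definition of S.\<close>

lemma mu_mean_in_convex_hull:
  fixes m :: "'k::finite \<Rightarrow> nat"
  assumes "s0 > 0" "lt > 0" "le > 0"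
  shows "mu_mean m y m0 s0 lt le \<in> convex hull (insert m0 (range (ybar m y)))"
proof -
  define S where "S = s0 + t_sum m lt le"
  have S: "S > 0"
    using t_sum_nonneg[of lt le m] assms by (simp add: S_def)
  define c where "c p = (case p of None \<Rightarrow> s0 | Some i \<Rightarrow> real (m i) * lt * le / (lt + real (m i) * le)) / S" for p
  define v where "v p = (case p of None \<Rightarrow> m0 | Some i \<Rightarrow> ybar m y i)" for p
  have "sum c UNIV = 1"
    using S by (simp add: sum_UNIV_option c_def sum_divide_distrib[symmetric] t_sum_def[symmetric]
        add_divide_distrib[symmetric]) (simp add: S_def)
  moreover have "c p \<ge> 0" for p
    using S assms by (auto simp: c_def split: option.splits)
  moreover have "v p \<in> convex hull (insert m0 (range (ybar m y)))" for p
    by (auto simp: v_def split: option.splits intro: hull_inc)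
  ultimately have "(\<Sum>p\<in>UNIV. c p *\<^sub>R v p) \<in> convex hull (insert m0 (range (ybar m y)))"
    by (intro convex_sum) auto
  also have "(\<Sum>p\<in>UNIV. c p *\<^sub>R v p) = mu_mean m y m0 s0 lt le"
    by (simp add: sum_UNIV_option c_def v_def mu_mean_def S_def add_divide_distrib
        sum_divide_distrib mult_ac)
  finally show ?thesis .
qed

section \<open>The transition density and its integral over \<lambda>\<close>

text \<open>Removes the matrix inverse and determinant, so that measurability and sign can be read
  off. No positivity of the new \<lambda> is assumed: otherwise a gamma factor makes both sides
  0.\<close>

lemma gibbs_density_eq:
  fixes m :: "'k::finite \<Rightarrow> nat"
  assumes "s0 > 0"
  shows "gibbs_density a1 b1 a2 b2 m0 s0 m y (l', \<xi>') s =
     gamma_density (real CARD('k) / 2 + a1) (v1 (theta_of \<xi>') (mu_of \<xi>') / 2 + b1) (fst (fst s)) *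
     gamma_density (real (\<Sum>i\<in>UNIV. m i) / 2 + a2) ((v2 m y (theta_of \<xi>') + SSE m y) / 2 + b2) (snd (fst s)) *
     (normal_density (mu_mean m y m0 s0 (fst (fst s)) (snd (fst s)))
        (1 / sqrt (s0 + t_sum m (fst (fst s)) (snd (fst s)))) (snd s $ None) *
      (\<Prod>i\<in>UNIV. normal_density
        ((fst (fst s) * snd s $ None + real (m i) * snd (fst s) * ybar m y i) /
           (fst (fst s) + real (m i) * snd (fst s)))
        (1 / sqrt (fst (fst s) + real (m i) * snd (fst s))) (snd s $ Some i)))"
proof (cases "fst (fst s) > 0 \<and> snd (fst s) > 0")
  case True
  then show ?thesis
    using assms by (simp add: gibbs_density_def mvnormal_density_xi case_prod_unfold)
next
  case False
  then show ?thesis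
    by (auto simp: gibbs_density_def case_prod_unfold) (auto simp: gamma_density_def)
qed

lemma borel_measurable_gibbs_density:
  fixes m :: "'k::finite \<Rightarrow> nat"
  assumes "s0 > 0"
  shows "gibbs_density a1 b1 a2 b2 m0 s0 m y s' \<in> borel_measurable borel"
proof -
  have [measurable]: "(\<lambda>s :: 'k state. snd s $ p) \<in> borel_measurable borel" for p
    by (intro borel_measurable_continuous_onI continuous_intros)
  have [measurable]: "(\<lambda>s :: 'k state. fst (fst s)) \<in> borel_measurable borel"
      "(\<lambda>s :: 'k state. snd (fst s)) \<in> borel_measurable borel"
    by (intro borel_measurable_continuous_onI continuous_intros)+
  have "gibbs_density a1 b1 a2 b2 m0 s0 m y (l', \<xi>') \<in> borel_measurable borel" for l' \<xi>'
    unfolding gibbs_density_eq[OF assms, abs_def] normal_density_def mu_mean_def t_sum_def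
    by measurable
  then show ?thesis
    by (cases s') simp
qed

lemma gibbs_density_nonneg:
  fixes m :: "'k::finite \<Rightarrow> nat"
  assumes "s0 > 0" "a1 > 0" "a2 > 0"
  shows "gibbs_density a1 b1 a2 b2 m0 s0 m y s' s \<ge> 0"
proof -
  have "gibbs_density a1 b1 a2 b2 m0 s0 m y (l', \<xi>') s \<ge> 0" for l' \<xi>'
    unfolding gibbs_density_eq[OF assms(1)] using assms
    by (intro mult_nonneg_nonneg prod_nonneg gamma_density_nonneg) (auto intro!: add_nonneg_pos sum_nonneg)
  then show ?thesis
    by (cases s') simp
qed

text \<open>Fubini with \<xi> innermost: the bound given \<lambda> is integrated against two
  independent gamma densities, and \<open>I1\<close>, \<open>I2\<close> are the resulting
  expectations of 1 / \<lambda>, of the form \<beta> / (\<alpha> - 1).\<close>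

lemma nn_integral_gibbs_le:
  fixes m :: "'k::finite \<Rightarrow> nat" and y :: "'k \<Rightarrow> nat \<Rightarrow> real" and m0 \<Delta> \<phi>1 \<phi>2 :: real
    and lt' le' :: real and \<xi>' :: "real ^ 'k option"
  assumes pos: "a1 > 0" "b1 > 0" "a2 > 0" "b2 > 0" "s0 > 0" and m: "\<And>i. m i > 0"
    and shape: "real CARD('k) / 2 + a1 > 1" "real (\<Sum>i\<in>UNIV. m i) / 2 + a2 > 1"
    and \<phi>: "\<phi>1 \<ge> 0" "\<phi>2 \<ge> 0"
  defines "\<Delta> \<equiv> measure lborel (convex hull (insert m0 (range (ybar m y))))"
    and "I1 \<equiv> (v1 (theta_of \<xi>') (mu_of \<xi>') / 2 + b1) / (real CARD('k) / 2 + a1 - 1)"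
    and "I2 \<equiv> ((v2 m y (theta_of \<xi>') + SSE m y) / 2 + b2) / (real (\<Sum>i\<in>UNIV. m i) / 2 + a2 - 1)"
  shows "(\<integral>\<^sup>+s. ennreal (gibbs_density a1 b1 a2 b2 m0 s0 m y ((lt', le'), \<xi>') s *
            (\<phi>1 * v1 (theta_of (snd s)) (mu_of (snd s)) + \<phi>2 * v2 m y (theta_of (snd s)))) \<partial>lborel) \<le>
     ennreal (\<phi>1 * (I1 + (\<Sum>i\<in>UNIV. 1 / real (m i)) * I2 + real CARD('k) * \<Delta>\<^sup>2) +
     \<phi>2 * ((real CARD('k) + 1) * I2 + real (\<Sum>i\<in>UNIV. m i) * \<Delta>\<^sup>2))" (is "?lhs \<le> ennreal ?rhs")
proof -
  define V where "V \<xi> = \<phi>1 * v1 (theta_of \<xi>) (mu_of \<xi>) + \<phi>2 * v2 m y (theta_of \<xi>)" for \<xi>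
  define f where "f s = gibbs_density a1 b1 a2 b2 m0 s0 m y ((lt', le'), \<xi>') s * V (snd s)" for s
  define \<alpha>1 where "\<alpha>1 = real CARD('k) / 2 + a1"
  define \<alpha>2 where "\<alpha>2 = real (\<Sum>i\<in>UNIV. m i) / 2 + a2"
  define \<beta>1 where "\<beta>1 = v1 (theta_of \<xi>') (mu_of \<xi>') / 2 + b1"
  define \<beta>2 where "\<beta>2 = (v2 m y (theta_of \<xi>') + SSE m y) / 2 + b2"
  define g1 where "g1 = gamma_density \<alpha>1 \<beta>1"
  define g2 where "g2 = gamma_density \<alpha>2 \<beta>2"
  \<comment> \<open>Coefficients of 1 / \<open>lt\<close>, 1 / \<open>le\<close> and 1 in the bound
    given \<lambda>.\<close>
  define A where "A = \<phi>1"
  define B where "B = \<phi>1 * (\<Sum>i\<in>UNIV. 1 / real (m i)) + \<phi>2 * (real CARD('k) + 1)"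
  define C where "C = \<phi>1 * real CARD('k) * \<Delta>\<^sup>2 + \<phi>2 * real (\<Sum>i\<in>UNIV. m i) * \<Delta>\<^sup>2"
  have ABC: "A \<ge> 0" "B \<ge> 0" "C \<ge> 0"
    using \<phi> by (auto simp: A_def B_def C_def intro!: add_nonneg_nonneg mult_nonneg_nonneg sum_nonneg)
  have \<beta>: "\<beta>1 > 0" "\<beta>2 > 0"
    using pos by (auto simp: \<beta>1_def \<beta>2_def v1_def v2_def SSE_def intro!: add_nonneg_pos add_nonneg_nonneg
        divide_nonneg_pos sum_nonneg)
  have \<alpha>: "\<alpha>1 > 1" "\<alpha>2 > 1"
    using shape by (simp_all add: \<alpha>1_def \<alpha>2_def)
  have g_nn: "g1 w \<ge> 0" "g2 w \<ge> 0" for w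
    using \<alpha> by (simp_all add: g1_def g2_def gamma_density_nonneg)
  have g_meas[measurable]: "g1 \<in> borel_measurable borel" "g2 \<in> borel_measurable borel"
    by (simp_all add: g1_def g2_def)
  have gz: "g1 w / w \<ge> 0" "g2 w / w \<ge> 0" for w
  proof -
    have "w \<le> 0 \<Longrightarrow> g1 w = 0 \<and> g2 w = 0"
      by (simp add: g1_def g2_def gamma_density_def)
    then show "g1 w / w \<ge> 0" "g2 w / w \<ge> 0"
      using g_nn[of w] by (cases "w > 0"; simp)+
  qed
  have V_meas[measurable]: "V \<in> borel_measurable borel"
    unfolding V_def v1_def v2_def theta_of_def mu_of_def
    by (intro borel_measurable_continuous_onI) (auto intro!: continuous_intros)
  have [measurable]: "(\<lambda>s. V (snd s)) \<in> borel_measurable (borel :: 'k state measure)"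
    by (rule measurable_compose[OF _ V_meas])
      (intro borel_measurable_continuous_onI continuous_intros)
  have [measurable]: "f \<in> borel_measurable borel"
    unfolding f_def using borel_measurable_gibbs_density[OF pos(5)] by measurable
  \<comment> \<open>Written with the quotients \<open>g1 lt / lt\<close> and
    \<open>g2 le / le\<close>, the bound holds for all real \<open>lt\<close> and \<open>le\<close>:
    off the positive quadrant the left side is 0.\<close>
  have inner: "(\<integral>\<^sup>+\<xi>. ennreal (f ((lt, le), \<xi>)) \<partial>lborel) \<le>
      ennreal (A * (g1 lt / lt * g2 le) + B * (g1 lt * (g2 le / le)) + C * (g1 lt * g2 le))" for lt le
  proof (cases "lt > 0 \<and> le > 0")
    case True
    let ?\<eta> = "mu_mean m y m0 s0 lt le" 
      and ?mvn = "mvnormal_density (xi_mean m y m0 s0 lt le) (xi_cov m s0 lt le)"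
    have \<Delta>: "\<bar>?\<eta> - ybar m y i\<bar> \<le> \<Delta>" for i
      unfolding \<Delta>_def using True pos
      by (intro abs_diff_le_length_convex_hull mu_mean_in_convex_hull hull_inc) auto
    have "(\<integral>\<^sup>+\<xi>. ennreal (f ((lt, le), \<xi>)) \<partial>lborel) =
        (\<integral>\<^sup>+\<xi>. ennreal (g1 lt * g2 le) * ennreal (?mvn \<xi> * V \<xi>) \<partial>lborel)"
      using g_nn by (simp add: f_def gibbs_density_def g1_def g2_def \<alpha>1_def \<alpha>2_def \<beta>1_def \<beta>2_def
          ennreal_mult'[symmetric] mult.assoc)
    also have "\<dots> = ennreal (g1 lt * g2 le) * (\<integral>\<^sup>+\<xi>. ennreal (?mvn \<xi> * V \<xi>) \<partial>lborel)"
    proof (rule nn_integral_cmult)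
      have [measurable]: "(\<lambda>\<xi> :: real ^ 'k option. \<xi> $ p) \<in> borel_measurable borel" for p
        by (intro borel_measurable_continuous_onI continuous_intros)
      show "(\<lambda>\<xi>. ennreal (?mvn \<xi> * V \<xi>)) \<in> borel_measurable lborel"
        using True pos by (simp add: mvnormal_density_xi normal_density_def)
    qed
    also have "\<dots> \<le> ennreal (g1 lt * g2 le) * ennreal (A / lt + B / le + C)"
    proof (intro mult_left_mono)
      have "\<phi>1 * (1 / lt + (\<Sum>i\<in>UNIV. 1 / real (m i)) / le + real CARD('k) * \<Delta>\<^sup>2) +
          \<phi>2 * ((real CARD('k) + 1) / le + real (\<Sum>i\<in>UNIV. m i) * \<Delta>\<^sup>2) = A / lt + B / le + C"
        by (simp add: A_def B_def C_def add_divide_distrib distrib_left)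
      then show "(\<integral>\<^sup>+\<xi>. ennreal (?mvn \<xi> * V \<xi>) \<partial>lborel) \<le> ennreal (A / lt + B / le + C)"
        using True drift_sum_le[where m = m and yb = "ybar m y" and \<eta> = ?\<eta> and lt = lt and le = le,
            OF pos(5) _ _ m \<phi> \<Delta>]
        unfolding V_def by (subst nn_integral_drift_xi[OF pos(5) _ _ \<phi>]) (auto intro!: ennreal_leI)
    qed simp
    also have "\<dots> = ennreal (A * (g1 lt / lt * g2 le) + B * (g1 lt * (g2 le / le)) + C * (g1 lt * g2 le))"
      using g_nn by (simp add: ennreal_mult'[symmetric] distrib_left mult_ac)
    finally show ?thesis .
  next
    case False
    then have "g1 lt * g2 le = 0"
      by (auto simp: g1_def g2_def gamma_density_def)
    then have "f ((lt, le), \<xi>) = 0" for \<xi>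
      by (simp add: f_def gibbs_density_def g1_def g2_def \<alpha>1_def \<alpha>2_def \<beta>1_def \<beta>2_def)
    then show ?thesis by simp
  qed
  have I: "(\<integral>\<^sup>+w. ennreal (g1 w) \<partial>lborel) = 1" "(\<integral>\<^sup>+w. ennreal (g2 w) \<partial>lborel) = 1"
      "(\<integral>\<^sup>+w. ennreal (g1 w / w) \<partial>lborel) = ennreal I1" "(\<integral>\<^sup>+w. ennreal (g2 w / w) \<partial>lborel) = ennreal I2"
    using \<alpha> \<beta> by (simp_all add: g1_def g2_def nn_integral_gamma_density nn_integral_gamma_density_inverse
        I1_def I2_def \<alpha>1_def \<alpha>2_def \<beta>1_def \<beta>2_def)
  have I0: "I1 \<ge> 0" "I2 \<ge> 0"
    using \<alpha> \<beta> by (simp_all add: I1_def I2_def \<alpha>1_def \<alpha>2_def \<beta>1_def \<beta>2_def less_imp_le)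
  have "?lhs = (\<integral>\<^sup>+s. ennreal (f s) \<partial>lborel)"
    by (simp add: f_def V_def)
  also have "\<dots> = (\<integral>\<^sup>+lt. \<integral>\<^sup>+le. \<integral>\<^sup>+\<xi>. ennreal (f ((lt, le), \<xi>)) \<partial>lborel \<partial>lborel \<partial>lborel)"
  proof -
    have f: "(\<lambda>s. ennreal (f s)) \<in> borel_measurable ((lborel \<Otimes>\<^sub>M lborel) \<Otimes>\<^sub>M lborel)"
      by (simp add: lborel_prod)
    show ?thesis
      using lborel.nn_integral_fst[OF f]
        lborel.nn_integral_fst[OF lborel.borel_measurable_nn_integral_fst[OF f]]
      by (simp add: lborel_prod)
  qed
  also have "\<dots> \<le>
      (\<integral>\<^sup>+lt. \<integral>\<^sup>+le. ennreal (A * (g1 lt / lt * g2 le) + B * (g1 lt * (g2 le / le)) + C * (g1 lt * g2 le))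
        \<partial>lborel \<partial>lborel)"
    by (intro nn_integral_mono inner)
  also have "\<dots> = (\<integral>\<^sup>+lt. \<integral>\<^sup>+le. ennreal A * ennreal (g1 lt / lt) * ennreal (g2 le) +
      ennreal B * ennreal (g1 lt) * ennreal (g2 le / le) + ennreal C * ennreal (g1 lt) * ennreal (g2 le)
        \<partial>lborel \<partial>lborel)"
  proof (intro nn_integral_cong)
    fix lt le
    show "ennreal (A * (g1 lt / lt * g2 le) + B * (g1 lt * (g2 le / le)) + C * (g1 lt * g2 le)) =
      ennreal A * ennreal (g1 lt / lt) * ennreal (g2 le) +
      ennreal B * ennreal (g1 lt) * ennreal (g2 le / le) + ennreal C * ennreal (g1 lt) * ennreal (g2 le)"
      using ABC g_nn gz mult_nonneg_nonneg
      by (simp only: ennreal_mult[symmetric] ennreal_plus[symmetric] mult_nonneg_nonneg add_nonneg_nonneg mult.assoc)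
  qed
  \<comment> \<open>Each of the three terms is a product of a function of \<open>lt\<close> and a
    function of \<open>le\<close>, so the iterated integrals factor.\<close>
  also have "\<dots> = ennreal A * ennreal I1 + ennreal B * ennreal I2 + ennreal C"
    by (simp add: nn_integral_add nn_integral_cmult nn_integral_multc I mult.commute mult.left_commute)
  also have "\<dots> = ennreal (A * I1 + B * I2 + C)"
    using ABC I0 by (simp add: ennreal_mult[symmetric] ennreal_plus[symmetric] del: ennreal_plus)
  also have "A * I1 + B * I2 + C = ?rhs"
    by (simp add: A_def B_def C_def algebra_simps)
  finally show ?thesis .
qed

section \<open>Drift inequality with the stated constants\<close>

theorem proposition4p1:
  fixes m :: "'k::finite \<Rightarrow> nat" and y :: "'k \<Rightarrow> nat \<Rightarrow> real"
    and a1 b1 a2 b2 s0 m0 :: real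
    and K M :: real
    and \<delta>1 \<delta>2 \<delta>3 \<delta>4 \<delta> c1 c2 \<Delta> \<gamma> \<phi>1 \<phi>2 b :: real
    and V1 :: "real ^ 'k \<Rightarrow> real \<Rightarrow> real"
    and lt' le' :: real and \<xi>' :: "real ^ 'k option"
  assumes "a1 > 0" "b1 > 0" "a2 > 0" "b2 > 0" "s0 > 0"
    and "CARD('k) \<ge> 3"
    and "\<And>i. m i \<ge> 2"
    and "K = real CARD('k)"
    and "M = real (\<Sum>i\<in>UNIV. m i)"
    and "\<delta>1 = 1 / (2 * a1 + K - 2)"
    and "\<delta>2 = 1 / (2 * a2 + M - 2)"
    and "\<delta>3 = (K + 1) * \<delta>2"
    and "\<delta>4 = \<delta>2 * (\<Sum>i\<in>UNIV. 1 / real (m i))"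
    and "\<delta> = max \<delta>1 \<delta>3"
    and "c1 = 2 * b1 / (2 * a1 + K - 2)"
    and "c2 = (2 * b2 + SSE m y) / (2 * a2 + M - 2)"
    and "\<Delta> = measure lborel (convex hull (insert m0 (range (ybar m y))))"
    and "\<delta> < \<gamma>" "\<gamma> < 1"
    and "\<phi>1 > 0" "\<phi>2 > 0"
    and "\<phi>1 * \<delta>4 / \<phi>2 + \<delta> < \<gamma>"
    and "\<And>\<theta> \<mu>. V1 \<theta> \<mu> = \<phi>1 * v1 \<theta> \<mu> + \<phi>2 * v2 m y \<theta>"
    and "b = \<phi>1 * (c1 + c2 * (\<Sum>i\<in>UNIV. 1 / real (m i)) + K * \<Delta>\<^sup>2)
           + \<phi>2 * (c2 * (K + 1) + M * \<Delta>\<^sup>2)"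
    and "lt' > 0" "le' > 0"
  shows "integrable (gibbs_kernel a1 b1 a2 b2 m0 s0 m y ((lt', le'), \<xi>'))
           (\<lambda>(_, \<xi>). V1 (theta_of \<xi>) (mu_of \<xi>)) \<and>
         (\<integral>(_, \<xi>). V1 (theta_of \<xi>) (mu_of \<xi>)
            \<partial>gibbs_kernel a1 b1 a2 b2 m0 s0 m y ((lt', le'), \<xi>'))
         \<le> \<gamma> * V1 (theta_of \<xi>') (mu_of \<xi>') + b"
proof -
  note pos = assms(1-5) and K = assms(8) and M = assms(9) and \<delta>s = assms(10-14) and c1 = assms(15)
    and c2 = assms(16) and \<Delta> = assms(17) and \<phi> = assms(20,21) and \<gamma> = assms(22) and V1 = assms(23)
    and b = assms(24)
  define r where "r = (\<Sum>i\<in>UNIV. 1 / real (m i))"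
  define v where "v = v1 (theta_of \<xi>') (mu_of \<xi>')"
  define w where "w = v2 m y (theta_of \<xi>')"
  \<comment> \<open>\<open>I1\<close> and \<open>I2\<close> are the expectations of the inverse new
    precisions given the current state; \<open>U\<close> is the resulting bound before the constants
    \<delta> and c are split off.\<close>
  define I1 where "I1 = (v / 2 + b1) / (K / 2 + a1 - 1)"
  define I2 where "I2 = ((w + SSE m y) / 2 + b2) / (M / 2 + a2 - 1)"
  define U where "U = \<phi>1 * (I1 + r * I2 + K * \<Delta>\<^sup>2) + \<phi>2 * ((K + 1) * I2 + M * \<Delta>\<^sup>2)"
  let ?g = "gibbs_density a1 b1 a2 b2 m0 s0 m y ((lt', le'), \<xi>')"
  have K3: "K \<ge> 3"
    using assms(6) K by simp
  \<comment> \<open>K >= 3 and M >= 6 put both gamma shapes above 1, which makes the inverse moments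
    finite.\<close>
  have "M \<ge> (\<Sum>i\<in>(UNIV :: 'k set). 2)"
    unfolding M of_nat_sum using assms(7)
    by (intro sum_mono) (metis of_nat_le_iff of_nat_numeral)
  then have M6: "M \<ge> 6"
    using K3 K by simp
  have m0: "m i > 0" for i
    using assms(7)[of i] by simp
  have v0: "v \<ge> 0" and w0: "w \<ge> 0" and sse0: "SSE m y \<ge> 0" and r0: "r \<ge> 0"
    by (auto simp: v_def w_def r_def v1_def v2_def SSE_def intro!: sum_nonneg)
  have d1: "2 * a1 + K - 2 > 0" and d2: "2 * a2 + M - 2 > 0"
    using pos K3 M6 by auto
  have V_nn: "V1 \<theta> \<mu> \<ge> 0" for \<theta> \<mu>
    using \<phi> unfolding V1 v1_def v2_def by (intro add_nonneg_nonneg mult_nonneg_nonneg sum_nonneg) auto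
  have nn: "(\<integral>\<^sup>+s. ennreal (?g s * V1 (theta_of (snd s)) (mu_of (snd s))) \<partial>lborel) \<le> ennreal U"
    using nn_integral_gibbs_le[where m = m and y = y and ?\<phi>1.0 = \<phi>1 and ?\<phi>2.0 = \<phi>2 and \<xi>' = \<xi>',
        OF pos m0] pos \<phi> K3 M6
    unfolding V1 U_def I1_def I2_def v_def w_def r_def K M \<Delta> by simp
  \<comment> \<open>Needed to return from \<open>ennreal U\<close> to a real bound, as
    \<open>ennreal\<close> sends negative numbers to 0.\<close>
  have U0: "U \<ge> 0"
    using \<phi> pos K3 M6 v0 w0 sse0 r0
    by (auto simp: U_def I1_def I2_def intro!: add_nonneg_nonneg mult_nonneg_nonneg divide_nonneg_pos)
  have g_meas[measurable]: "?g \<in> borel_measurable borel"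
    using borel_measurable_gibbs_density[OF pos(5)] .
  have g_nn: "?g s \<ge> 0" for s
    using pos by (intro gibbs_density_nonneg)
  have V_meas: "(\<lambda>s :: 'k state. V1 (theta_of (snd s)) (mu_of (snd s))) \<in> borel_measurable borel"
    unfolding V1 v1_def v2_def theta_of_def mu_of_def
    by (intro borel_measurable_continuous_onI) (auto intro!: continuous_intros)
  have U_le: "U \<le> \<gamma> * V1 (theta_of \<xi>') (mu_of \<xi>') + b"
  proof -
    \<comment> \<open>Doubling numerator and denominator produces the denominators of
      \<open>\<delta>1\<close> and \<open>c1\<close>; the state-dependent part separates from the
      constant.\<close>
    have I1: "I1 = \<delta>1 * v + c1"
      unfolding I1_def \<delta>s c1
      by (subst mult_divide_mult_cancel_left[of 2, symmetric])
         (simp_all add: algebra_simps flip: add_divide_distrib)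
    have I2: "I2 = \<delta>2 * w + c2"
      unfolding I2_def \<delta>s c2
      by (subst mult_divide_mult_cancel_left[of 2, symmetric])
         (simp_all add: algebra_simps flip: add_divide_distrib)
    \<comment> \<open>The term \<phi>1 \<delta>4 w is rewritten as a multiple of \<phi>2 w, which
      brings in the ratio \<phi>1 \<delta>4 / \<phi>2 of the hypothesis on \<gamma>.\<close>
    have "U = \<phi>1 * \<delta>1 * v + (\<phi>1 * \<delta>4 / \<phi>2 + \<delta>3) * (\<phi>2 * w) + b"
      using \<phi> by (simp add: U_def I1 I2 b \<delta>s(3,4) r_def[symmetric] field_simps)
    also have "\<dots> \<le> \<gamma> * (\<phi>1 * v) + \<gamma> * (\<phi>2 * w) + b"
    proof (intro add_mono order_refl)
      have "\<delta>1 \<le> \<gamma>"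
        using assms(14,18) by simp
      then show "\<phi>1 * \<delta>1 * v \<le> \<gamma> * (\<phi>1 * v)"
        using \<phi> v0 by (simp add: mult_right_mono mult.left_commute[of \<phi>1] mult.assoc)
      show "(\<phi>1 * \<delta>4 / \<phi>2 + \<delta>3) * (\<phi>2 * w) \<le> \<gamma> * (\<phi>2 * w)"
        using \<gamma> assms(14) \<phi> w0 by (intro mult_right_mono) auto
    qed
    finally show ?thesis
      by (simp add: V1 v_def w_def distrib_left)
  qed
  have "(\<integral>\<^sup>+s. ennreal (V1 (theta_of (snd s)) (mu_of (snd s)))
        \<partial>gibbs_kernel a1 b1 a2 b2 m0 s0 m y ((lt', le'), \<xi>')) =
      (\<integral>\<^sup>+s. ennreal (?g s * V1 (theta_of (snd s)) (mu_of (snd s))) \<partial>lborel)"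
    unfolding gibbs_kernel_def using V_meas
    by (subst nn_integral_density) (auto simp: ennreal_mult g_nn V_nn)
  with nn have nn': "(\<integral>\<^sup>+s. ennreal (V1 (theta_of (snd s)) (mu_of (snd s)))
      \<partial>gibbs_kernel a1 b1 a2 b2 m0 s0 m y ((lt', le'), \<xi>')) \<le> ennreal U"
    by simp
  have V_meas': "(\<lambda>s. V1 (theta_of (snd s)) (mu_of (snd s))) \<in>
      borel_measurable (gibbs_kernel a1 b1 a2 b2 m0 s0 m y ((lt', le'), \<xi>'))"
    using V_meas by (simp add: gibbs_kernel_def)
  \<comment> \<open>The function is nonnegative and its \<open>ennreal\<close> integral is at most
    \<open>ennreal U\<close>, hence finite.\<close>
  have "integrable (gibbs_kernel a1 b1 a2 b2 m0 s0 m y ((lt', le'), \<xi>'))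
      (\<lambda>s. V1 (theta_of (snd s)) (mu_of (snd s)))"
    using nn' V_nn by (intro integrableI_nonneg[OF V_meas']) (auto intro: le_less_trans)
  moreover have "(\<integral>s. V1 (theta_of (snd s)) (mu_of (snd s))
      \<partial>gibbs_kernel a1 b1 a2 b2 m0 s0 m y ((lt', le'), \<xi>')) \<le> U"
    using nn' V_nn U0 by (subst integral_eq_nn_integral[OF V_meas']) (auto intro: enn2real_leI)
  ultimately show ?thesis
    using U_le by (simp add: case_prod_unfold)
qed

end
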